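(* Let $\lambda>0$ and $T>0$, and let $\sigma\in L^1[0,T]$ be non-negative. Let $\bar{\sigma}=\frac{1}{T}\int_0^T\sigma(t)\,dt$, let $x_p$ be the solution on $[0,T]$ of $x'(t)=\sigma(t)(1-x(t))-\lambda x(t)$ satisfying $x_p(0)=x_p(T)$, and let $w[\sigma]=\lambda\cdot\frac{1}{T}\int_0^T x_p(t)\,dt$. Then $$w[\sigma]=w[\bar{\sigma}]-\frac{1}{T}\int_0^T\left(x_p(t)-x^*\right)^2(\lambda+\sigma(t))\,dt,$$ where $x^*=\frac{\bar{\sigma}}{\lambda+\bar{\sigma}}$.
   Context: Solutions of the differential equation $x'(t)=\sigma(t)(1-x(t))-\lambda x(t)$ are understood in the Carathéodory sense: $x$ is absolutely continuous on $[0,T]$ and satisfies the equation for almost every $t$. The solution $x_p$ with $x_p(0)=x_p(T)$ is unique. The notation $w[\bar\sigma]$ means the functional $w$ evaluated at the constant function equal to $\bar\sigma$, i.e. $w[\bar\sigma]=\frac{\lambda\bar\sigma}{\lambda+\bar\sigma}$. *)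

theory Defs
  imports "HOL-Analysis.Analysis"
begin

(* A finite family of non-overlapping subintervals of {a..b} is a set D with
   "D division_of \<Union>D" and \<Union>D contained in {a..b}. The members are nonempty
   compact intervals {Inf K..Sup K} with pairwise disjoint interiors; degenerate
   members contribute 0 to both sums. *)
definition abs_continuous_on_interval :: "real \<Rightarrow> real \<Rightarrow> (real \<Rightarrow> real) \<Rightarrow> bool" where
  "abs_continuous_on_interval a b f \<longleftrightarrow>
     (\<forall>\<epsilon>>0. \<exists>\<delta>>0. \<forall>D. D division_of \<Union>D \<and> \<Union>D \<subseteq> {a..b} \<and> (\<Sum>K\<in>D. Sup K - Inf K) < \<delta>
        \<longrightarrow> (\<Sum>K\<in>D. \<bar>f (Sup K) - f (Inf K)\<bar>) < \<epsilon>)"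

definition caratheodory_solution ::
    "real \<Rightarrow> real \<Rightarrow> (real \<Rightarrow> real) \<Rightarrow> (real \<Rightarrow> real) \<Rightarrow> bool" where
  "caratheodory_solution lam T \<sigma> x \<longleftrightarrow>
     abs_continuous_on_interval 0 T x \<and>
     (AE t\<in>{0..T} in lebesgue.
        (x has_real_derivative (\<sigma> t * (1 - x t) - lam * x t)) (at t within {0..T}))"

definition periodic_solution ::
    "real \<Rightarrow> real \<Rightarrow> (real \<Rightarrow> real) \<Rightarrow> (real \<Rightarrow> real) \<Rightarrow> bool" where
  "periodic_solution lam T \<sigma> x \<longleftrightarrow> caratheodory_solution lam T \<sigma> x \<and> x 0 = x T"

definition mean_value :: "real \<Rightarrow> (real \<Rightarrow> real) \<Rightarrow> real" where
  "mean_value T f = 1 / T * (LINT t:{0..T}|lebesgue. f t)"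

(* The periodic solution is unique only as a function on {0..T}, its values outside
   being arbitrary; hence the description is of the value of the functional. *)
definition w :: "real \<Rightarrow> real \<Rightarrow> (real \<Rightarrow> real) \<Rightarrow> real" where
  "w lam T \<sigma> = (THE v. \<exists>x. periodic_solution lam T \<sigma> x \<and> v = lam * mean_value T x)"

end

theory Submission
  imports Defs
begin

text \<open>
  Integrating the equation, and the equation multiplied by \<open>x\<^sub>p\<close>, over a period gives, since
  \<open>x\<^sub>p\<close> and \<open>x\<^sub>p\<^sup>2\<close> are absolutely continuous and periodic,
  \<open>\<integral>\<sigma> = \<integral>\<sigma> x\<^sub>p + \<lambda> \<integral>x\<^sub>p\<close> and \<open>\<integral>\<sigma> x\<^sub>p = \<integral>\<sigma> x\<^sub>p\<^sup>2 + \<lambda> \<integral>x\<^sub>p\<^sup>2\<close>.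
  Expanding the square, these two relations reduce the claim to algebra.
  The fundamental theorem of calculus for absolutely continuous functions is obtained from the
  gauge integral: off the exceptional null set the derivative controls the Riemann sums, while the
  intervals tagged in the null set lie in an open set of small measure.
  Uniqueness of the periodic solution follows in the same way by integrating the
  derivative of the squared difference of two solutions.
\<close>

section \<open>Null sets and the local estimate for derivatives\<close>

lemma AE_on_negligibleE:
  assumes "AE t\<in>S in lebesgue. P t"
  obtains N :: "'a::euclidean_space set" where "negligible N" "\<And>t. t \<in> S - N \<Longrightarrow> P t"
proof -
  obtain N where N: "N \<in> null_sets lebesgue" "{t \<in> space lebesgue. \<not> (t \<in> S \<longrightarrow> P t)} \<subseteq> N"
    using assms unfolding eventually_ae_filter by blast
  show thesis
  proof
    show "negligible N" using N(1) by (simp add: negligible_iff_null_sets)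
  qed (use N(2) in auto)
qed

text \<open>Outer regularity of Lebesgue measure. The open set \<open>U\<close> later serves as the
  gauge at every tag in the exceptional null set.\<close>

lemma negligible_outer_open_real:
  fixes N :: "real set"
  assumes "negligible N" "e > 0"
  obtains U where "open U" "N \<subseteq> U" "U \<in> lmeasurable" "measure lebesgue U < e"
proof -
  have N: "N \<in> null_sets lebesgue" using assms by (simp add: negligible_iff_null_sets)
  then have Ns: "N \<in> sets lebesgue" by auto
  obtain U where U: "open U" "N \<subseteq> U" "U - N \<in> lmeasurable" "emeasure lebesgue (U - N) < ennreal e"
    using sets_lebesgue_outer_open[OF Ns \<open>e > 0\<close>] by blast
  have "U \<in> sets lebesgue" using U(1) by auto
  then have em: "emeasure lebesgue U = emeasure lebesgue (U - N)"
    using N by (simp add: emeasure_Diff_null_set)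
  then have lm: "U \<in> lmeasurable"
    using \<open>U \<in> sets lebesgue\<close> U(3) by (auto simp: fmeasurable_def)
  have "ennreal (measure lebesgue U) < ennreal e"
    using em U(4) lm by (metis emeasure_eq_measure2)
  then have "measure lebesgue U < e" by (simp add: ennreal_less_iff)
  then show thesis using U lm that by blast
qed

text \<open>Because \<open>x\<close> lies between \<open>u\<close> and \<open>v\<close>, the
  linearisation errors \<open>e * (x - u)\<close> and \<open>e * (v - x)\<close> at the two ends add
  up to exactly \<open>e * (v - u)\<close>. This controls one term of a Riemann sum tagged at
  \<open>x\<close>.\<close>

lemma has_real_derivative_straddle:
  fixes f :: "real \<Rightarrow> real"
  assumes "(f has_real_derivative c) (at x within S)" "e > 0"
  obtains d where "d > 0"
    "\<And>u v. \<lbrakk>u \<in> S; v \<in> S; u \<le> x; x \<le> v; u \<in> ball x d; v \<in> ball x d\<rbrakk>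
      \<Longrightarrow> \<bar>(v - u) * c - (f v - f u)\<bar> \<le> e * (v - u)"
proof -
  have "(f has_derivative (\<lambda>h. h * c)) (at x within S)"
    using assms(1) by (simp add: has_field_derivative_def mult_commute_abs)
  then obtain d where d: "d > 0"
    "\<And>y. y \<in> S \<Longrightarrow> norm (y - x) < d \<Longrightarrow> norm (f y - f x - (y - x) * c) \<le> e * norm (y - x)"
    using \<open>e > 0\<close> unfolding has_derivative_within_alt by blast
  show thesis
  proof
    fix u v assume uv: "u \<in> S" "v \<in> S" "u \<le> x" "x \<le> v" "u \<in> ball x d" "v \<in> ball x d"
    have "\<bar>f u - f x - (u - x) * c\<bar> \<le> e * (x - u)"
      using d(2)[of u] uv by (auto simp: dist_real_def)
    moreover have "\<bar>f v - f x - (v - x) * c\<bar> \<le> e * (v - x)"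
      using d(2)[of v] uv by (auto simp: dist_real_def)
    ultimately show "\<bar>(v - u) * c - (f v - f u)\<bar> \<le> e * (v - u)"
      by (simp add: algebra_simps abs_le_iff)
  qed (rule d(1))
qed

section \<open>Absolutely continuous functions\<close>

lemma abs_continuous_on_intervalD:
  assumes "abs_continuous_on_interval a b f" "\<epsilon> > 0"
  obtains \<delta> where "\<delta> > 0"
    "\<And>D. \<lbrakk>D division_of \<Union>D; \<Union>D \<subseteq> {a..b}; (\<Sum>K\<in>D. Sup K - Inf K) < \<delta>\<rbrakk>
      \<Longrightarrow> (\<Sum>K\<in>D. \<bar>f (Sup K) - f (Inf K)\<bar>) < \<epsilon>"
  using assms unfolding abs_continuous_on_interval_def by meson

lemma division_member_bounds_real:
  fixes D :: "real set set"
  assumes "D division_of S" "S \<subseteq> {a..b}" "K \<in> D"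
  shows "Inf K \<in> {a..b}" "Sup K \<in> {a..b}" "Inf K \<le> Sup K" "K = {Inf K..Sup K}"
proof -
  obtain u v where K: "K = {u..v}" "K \<noteq> {}"
    using division_ofD(3,4)[OF assms(1,3)] by (metis box_real(2))
  then have "u \<le> v" by simp
  moreover have "K \<subseteq> {a..b}" using division_ofD(2)[OF assms(1,3)] assms(2) by blast
  ultimately show "Inf K \<in> {a..b}" "Sup K \<in> {a..b}" "Inf K \<le> Sup K" "K = {Inf K..Sup K}"
    using K by auto
qed

lemma abs_continuous_on_interval_Lipschitz_image:
  assumes f: "abs_continuous_on_interval a b f"
    and L: "\<And>s t. \<lbrakk>s \<in> {a..b}; t \<in> {a..b}\<rbrakk> \<Longrightarrow> \<bar>h s - h t\<bar> \<le> L * \<bar>f s - f t\<bar>"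
  shows "abs_continuous_on_interval a b h"
  unfolding abs_continuous_on_interval_def
proof (intro allI impI)
  fix e :: real assume e: "e > 0"
  \<comment> \<open>The maximum with 1 makes \<open>M\<close> positive whatever the sign of
    \<open>L\<close>, so \<open>e / M\<close> is an admissible tolerance for
    \<open>f\<close>.\<close>
  define M where "M = max L 1"
  have M: "M > 0" "L \<le> M" by (auto simp: M_def)
  obtain d where d: "d > 0"
    "\<And>D. \<lbrakk>D division_of \<Union>D; \<Union>D \<subseteq> {a..b}; (\<Sum>K\<in>D. Sup K - Inf K) < d\<rbrakk>
      \<Longrightarrow> (\<Sum>K\<in>D. \<bar>f (Sup K) - f (Inf K)\<bar>) < e / M"
    using abs_continuous_on_intervalD[OF f divide_pos_pos[OF e M(1)]] by blast
  show "\<exists>\<delta>>0. \<forall>D. D division_of \<Union>D \<and> \<Union>D \<subseteq> {a..b} \<and> (\<Sum>K\<in>D. Sup K - Inf K) < \<delta>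
        \<longrightarrow> (\<Sum>K\<in>D. \<bar>h (Sup K) - h (Inf K)\<bar>) < e"
  proof (intro exI[of _ d] conjI allI impI d(1))
    fix D :: "real set set"
    assume D: "D division_of \<Union>D \<and> \<Union>D \<subseteq> {a..b} \<and> (\<Sum>K\<in>D. Sup K - Inf K) < d"
    have "(\<Sum>K\<in>D. \<bar>h (Sup K) - h (Inf K)\<bar>) \<le> (\<Sum>K\<in>D. M * \<bar>f (Sup K) - f (Inf K)\<bar>)"
    proof (rule sum_mono)
      fix K assume "K \<in> D"
      then have "\<bar>h (Sup K) - h (Inf K)\<bar> \<le> L * \<bar>f (Sup K) - f (Inf K)\<bar>"
        using D division_member_bounds_real by (intro L) blast+
      also have "\<dots> \<le> M * \<bar>f (Sup K) - f (Inf K)\<bar>"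
        using M by (intro mult_right_mono) auto
      finally show "\<bar>h (Sup K) - h (Inf K)\<bar> \<le> M * \<bar>f (Sup K) - f (Inf K)\<bar>" .
    qed
    also have "\<dots> = M * (\<Sum>K\<in>D. \<bar>f (Sup K) - f (Inf K)\<bar>)" by (simp add: sum_distrib_left)
    also have "\<dots> < M * (e / M)" using d(2)[of D] D M by (intro mult_strict_left_mono) auto
    finally show "(\<Sum>K\<in>D. \<bar>h (Sup K) - h (Inf K)\<bar>) < e" using M by simp
  qed
qed

lemma abs_continuous_on_interval_const: "abs_continuous_on_interval a b (\<lambda>_. c)"
  unfolding abs_continuous_on_interval_def by (auto intro: exI[of _ 1])

lemma abs_continuous_on_interval_diff:
  assumes f: "abs_continuous_on_interval a b f" and g: "abs_continuous_on_interval a b g"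
  shows "abs_continuous_on_interval a b (\<lambda>t. f t - g t)"
  unfolding abs_continuous_on_interval_def
proof (intro allI impI)
  fix e :: real assume e: "e > 0"
  obtain d1 where d1: "d1 > 0"
    "\<And>D. \<lbrakk>D division_of \<Union>D; \<Union>D \<subseteq> {a..b}; (\<Sum>K\<in>D. Sup K - Inf K) < d1\<rbrakk>
      \<Longrightarrow> (\<Sum>K\<in>D. \<bar>f (Sup K) - f (Inf K)\<bar>) < e / 2"
    using abs_continuous_on_intervalD[OF f half_gt_zero[OF e]] by blast
  obtain d2 where d2: "d2 > 0"
    "\<And>D. \<lbrakk>D division_of \<Union>D; \<Union>D \<subseteq> {a..b}; (\<Sum>K\<in>D. Sup K - Inf K) < d2\<rbrakk>
      \<Longrightarrow> (\<Sum>K\<in>D. \<bar>g (Sup K) - g (Inf K)\<bar>) < e / 2"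
    using abs_continuous_on_intervalD[OF g half_gt_zero[OF e]] by blast
  show "\<exists>\<delta>>0. \<forall>D. D division_of \<Union>D \<and> \<Union>D \<subseteq> {a..b} \<and> (\<Sum>K\<in>D. Sup K - Inf K) < \<delta>
        \<longrightarrow> (\<Sum>K\<in>D. \<bar>f (Sup K) - g (Sup K) - (f (Inf K) - g (Inf K))\<bar>) < e"
  proof (intro exI[of _ "min d1 d2"] conjI allI impI)
    fix D :: "real set set"
    assume D: "D division_of \<Union>D \<and> \<Union>D \<subseteq> {a..b} \<and> (\<Sum>K\<in>D. Sup K - Inf K) < min d1 d2"
    have "(\<Sum>K\<in>D. \<bar>f (Sup K) - g (Sup K) - (f (Inf K) - g (Inf K))\<bar>)
        \<le> (\<Sum>K\<in>D. \<bar>f (Sup K) - f (Inf K)\<bar> + \<bar>g (Sup K) - g (Inf K)\<bar>)"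
      by (rule sum_mono) linarith
    also have "\<dots> < e" using d1(2)[of D] d2(2)[of D] D by (simp add: sum.distrib)
    finally show "(\<Sum>K\<in>D. \<bar>f (Sup K) - g (Sup K) - (f (Inf K) - g (Inf K))\<bar>) < e" .
  qed (use d1 d2 in auto)
qed

text \<open>A single interval is itself a division, so testing the definition on
  \<open>{{u..v}}\<close> gives continuity with the same \<open>d\<close> at every point.\<close>

lemma abs_continuous_on_interval_imp_continuous_on:
  assumes f: "abs_continuous_on_interval a b f"
  shows "continuous_on {a..b} f"
  unfolding continuous_on_iff
proof (intro ballI allI impI)
  fix s e :: real assume s: "s \<in> {a..b}" and e: "e > 0"
  obtain d where d: "d > 0"
    "\<And>D. \<lbrakk>D division_of \<Union>D; \<Union>D \<subseteq> {a..b}; (\<Sum>K\<in>D. Sup K - Inf K) < d\<rbrakk>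
      \<Longrightarrow> (\<Sum>K\<in>D. \<bar>f (Sup K) - f (Inf K)\<bar>) < e"
    using abs_continuous_on_intervalD[OF f e] by blast
  have *: "\<bar>f v - f u\<bar> < e" if "u \<in> {a..b}" "v \<in> {a..b}" "u \<le> v" "v - u < d" for u v
    using d(2)[of "{{u..v}}"] that division_of_self[of u v] by auto
  show "\<exists>d>0. \<forall>t\<in>{a..b}. dist t s < d \<longrightarrow> dist (f t) (f s) < e"
  proof (intro exI[of _ d] conjI ballI impI d(1))
    fix t assume t: "t \<in> {a..b}" "dist t s < d"
    show "dist (f t) (f s) < e"
      using *[of s t] *[of t s] s t by (cases "s \<le> t") (auto simp: dist_real_def)
  qed
qed

text \<open>By compactness \<open>f\<close> is bounded by some \<open>B\<close>, and squaring is
  Lipschitz with constant \<open>2 * B\<close> on the range of \<open>f\<close>.\<close>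

lemma abs_continuous_on_interval_power2:
  assumes f: "abs_continuous_on_interval a b f"
  shows "abs_continuous_on_interval a b (\<lambda>t. (f t)\<^sup>2)"
proof -
  have "bounded (f ` {a..b})"
    using abs_continuous_on_interval_imp_continuous_on[OF f]
    by (intro compact_imp_bounded compact_continuous_image) auto
  then obtain B where B: "\<And>t. t \<in> {a..b} \<Longrightarrow> \<bar>f t\<bar> \<le> B"
    unfolding bounded_iff by (metis imageI real_norm_def)
  show ?thesis
  proof (rule abs_continuous_on_interval_Lipschitz_image[OF f])
    fix s t assume "s \<in> {a..b}" "t \<in> {a..b}"
    then have "\<bar>f s + f t\<bar> \<le> 2 * B" using B[of s] B[of t] by linarith
    moreover have "\<bar>(f s)\<^sup>2 - (f t)\<^sup>2\<bar> = \<bar>f s + f t\<bar> * \<bar>f s - f t\<bar>"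
      by (simp add: power2_eq_square square_diff_square_factored abs_mult)
    ultimately show "\<bar>(f s)\<^sup>2 - (f t)\<^sup>2\<bar> \<le> (2 * B) * \<bar>f s - f t\<bar>"
      by (simp add: mult_right_mono)
  qed
qed

text \<open>Integrability of \<open>g\<close> is part of the conclusion: the Riemann sums are
  compared directly with the telescoping increments of \<open>f\<close>. Tags off \<open>N\<close>
  and tags in \<open>N\<close> each get half of the error \<open>e * (b - a)\<close>.\<close>

theorem fundamental_theorem_of_calculus_abs_continuous:
  fixes f g :: "real \<Rightarrow> real"
  assumes "a \<le> b" and f: "abs_continuous_on_interval a b f"
    and N: "negligible N"
    and deriv: "\<And>t. t \<in> {a..b} - N \<Longrightarrow> (f has_real_derivative g t) (at t within {a..b})"
  shows "(g has_integral (f b - f a)) {a..b}"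
proof (cases "a = b")
  case True
  then show ?thesis by (simp add: has_integral_refl)
next
  case False
  then have ab: "a < b" using \<open>a \<le> b\<close> by simp
  \<comment> \<open>With the value 0 on \<open>N\<close>, a term tagged in \<open>N\<close>
    contributes only the increment of \<open>f\<close> to the error.\<close>
  define g' where "g' t = (if t \<in> N then 0 else g t)" for t
  have "(g' has_integral (f b - f a)) {a..b}"
    unfolding has_integral_factor_content_real
  proof (intro allI impI)
    fix e :: real assume "e > 0"
    then have e2: "e / 2 > 0" by simp
    \<comment> \<open>The implication makes the claim hold for every real \<open>x\<close>, so that
      choice yields a positive radius function \<open>d\<close> on the whole line.\<close>
    have "\<exists>d>0. x \<in> {a..b} - N \<longrightarrow> (\<forall>u v. u \<in> {a..b} \<and> v \<in> {a..b} \<and> u \<le> x \<and> x \<le> v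
        \<and> u \<in> ball x d \<and> v \<in> ball x d \<longrightarrow> \<bar>(v - u) * g x - (f v - f u)\<bar> \<le> e / 2 * (v - u))" for x
    proof (cases "x \<in> {a..b} - N")
      case True
      then show ?thesis
        using has_real_derivative_straddle[OF deriv[OF True] e2] by metis
    qed (use zero_less_one in blast)
    then obtain d where d: "\<And>x. d x > 0"
      "\<And>x u v. \<lbrakk>x \<in> {a..b} - N; u \<in> {a..b}; v \<in> {a..b}; u \<le> x; x \<le> v; u \<in> ball x (d x);
        v \<in> ball x (d x)\<rbrakk> \<Longrightarrow> \<bar>(v - u) * g x - (f v - f u)\<bar> \<le> e / 2 * (v - u)"
      by metis
    \<comment> \<open>The tolerance for intervals tagged in \<open>N\<close> must be strictly
      positive; this is why \<open>a = b\<close> was split off.\<close>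
    have eab: "e / 2 * (b - a) > 0" using e2 ab by simp
    obtain \<delta> where \<delta>: "\<delta> > 0"
      "\<And>D. \<lbrakk>D division_of \<Union>D; \<Union>D \<subseteq> {a..b}; (\<Sum>K\<in>D. Sup K - Inf K) < \<delta>\<rbrakk>
        \<Longrightarrow> (\<Sum>K\<in>D. \<bar>f (Sup K) - f (Inf K)\<bar>) < e / 2 * (b - a)"
      using abs_continuous_on_intervalD[OF f eab] by blast
    obtain U where U: "open U" "N \<subseteq> U" "U \<in> lmeasurable" "measure lebesgue U < \<delta>"
      using negligible_outer_open_real[OF N \<delta>(1)] by blast
    define G where "G x = (if x \<in> N then U else ball x (d x))" for x
    have gauge: "gauge G" using U d(1) by (auto simp: gauge_def G_def)
    have riemann: "norm ((\<Sum>(x,K)\<in>p. measure lborel K *\<^sub>R g' x) - (f b - f a)) \<le> e * measure lborel {a..b}"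
      if p: "p tagged_division_of {a..b}" and fine: "G fine p" for p
    proof -
      have telescope: "(\<Sum>(x,K)\<in>p. Sup K - Inf K) = b - a"
          "(\<Sum>(x,K)\<in>p. f (Sup K) - f (Inf K)) = f b - f a"
        using additive_tagged_division_1[OF \<open>a \<le> b\<close> p, of "\<lambda>x. x"]
          additive_tagged_division_1[OF \<open>a \<le> b\<close> p, of f] by auto
      have fin: "finite p" using p by auto
      have mem: "\<exists>u v. K = {u..v} \<and> u \<le> v \<and> u \<in> {a..b} \<and> v \<in> {a..b} \<and> x \<in> K \<and> K \<subseteq> G x"
        if "(x,K) \<in> p" for x K
      proof -
        have "x \<in> K" "K \<subseteq> {a..b}" "K \<subseteq> G x" "\<exists>u v. K = {u..v}"
          using that p fine tagged_division_ofD(2,3,4)[OF p that] by (auto simp: fine_def)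
        then show ?thesis by force
      qed
      \<comment> \<open>\<open>q\<close> collects the pairs tagged in \<open>N\<close>;
        \<open>D\<close> forgets the tags, since absolute continuity speaks of plain
        divisions.\<close>
      define q where "q = {z \<in> p. fst z \<in> N}"
      define D where "D = snd ` q"
      have "q tagged_partial_division_of {a..b}"
        using p tagged_partial_division_subset[of p "{a..b}" q]
        by (auto simp: q_def tagged_division_of_def)
      then have Ddiv: "D division_of \<Union>D" and qtag: "q tagged_division_of \<Union>D"
        unfolding D_def
        by (auto intro: partial_division_of_tagged_division tagged_partial_division_of_Union_self)
      have Dsub: "\<Union>D \<subseteq> {a..b}" "\<Union>D \<subseteq> U"
        using mem by (fastforce simp: D_def q_def G_def)+
      \<comment> \<open>The total length is the measure of the union, which lies in \<open>U\<close>
        and hence has measure below \<open>\<delta>\<close>.\<close>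
      have "(\<Sum>K\<in>D. Sup K - Inf K) = (\<Sum>K\<in>D. measure lebesgue K)"
      proof (rule sum.cong[OF refl])
        fix K assume "K \<in> D"
        note K = division_member_bounds_real[OF Ddiv Dsub(1) this]
        show "Sup K - Inf K = measure lebesgue K"
          using K(3) by (subst (3) K(4)) simp
      qed
      also have "\<dots> = measure lebesgue (\<Union>D)" by (rule content_division[OF Ddiv])
      also have "\<dots> \<le> measure lebesgue U"
        using Dsub(2) lmeasurable_division[OF Ddiv] U(3) by (intro measure_mono_fmeasurable) auto
      finally have "(\<Sum>K\<in>D. Sup K - Inf K) < \<delta>" using U(4) by simp
      then have "(\<Sum>K\<in>D. \<bar>f (Sup K) - f (Inf K)\<bar>) < e / 2 * (b - a)"
        by (rule \<delta>(2)[OF Ddiv Dsub(1)])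
      \<comment> \<open>Distinct pairs of \<open>q\<close> can share an interval only if its
        interior is disjoint from itself, so the interval is a point and its increment vanishes.
        Dropping tags therefore keeps the sum.\<close>
      moreover have "(\<Sum>(x,K)\<in>q. \<bar>f (Sup K) - f (Inf K)\<bar>) = (\<Sum>K\<in>D. \<bar>f (Sup K) - f (Inf K)\<bar>)"
        unfolding D_def
      proof (subst sum.reindex_nontrivial)
        fix y z assume yz: "y \<in> q" "z \<in> q" "y \<noteq> z" "snd y = snd z"
        obtain x x' K where eq: "y = (x, K)" "z = (x', K)"
          using yz(4) by (metis prod.collapse)
        have "interior K \<inter> interior K = {}"
          using tagged_division_ofD(5)[OF qtag, of x K x' K] yz eq by auto
        moreover obtain u v where "K = {u..v}" "u \<le> v"
          using mem[of x K] yz(1) eq by (auto simp: q_def)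
        ultimately show "\<bar>f (Sup (snd y)) - f (Inf (snd y))\<bar> = 0"
          using eq by (simp add: interior_atLeastAtMost_real)
      qed (use fin in \<open>auto simp: q_def case_prod_beta\<close>)
      ultimately have q_small: "(\<Sum>(x,K)\<in>q. \<bar>f (Sup K) - f (Inf K)\<bar>) < e / 2 * (b - a)"
        by simp
      \<comment> \<open>Termwise bound: the straddle estimate for tags off \<open>N\<close>, the
        bare increment of \<open>f\<close> for tags in \<open>N\<close>.\<close>
      have "\<bar>(\<Sum>(x,K)\<in>p. measure lborel K *\<^sub>R g' x - (f (Sup K) - f (Inf K)))\<bar>
          \<le> (\<Sum>(x,K)\<in>p. e / 2 * (Sup K - Inf K) + (if x \<in> N then \<bar>f (Sup K) - f (Inf K)\<bar> else 0))"
      proof (rule order_trans[OF sum_abs], rule sum_mono, clarify)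
        fix x K assume "(x,K) \<in> p"
        then obtain u v where K: "K = {u..v}" "u \<le> v" "u \<in> {a..b}" "v \<in> {a..b}" "x \<in> K" "K \<subseteq> G x"
          using mem by blast
        have x: "x \<in> {a..b}" using K by auto
        have uv: "u \<in> G x" "v \<in> G x" using K by auto
        show "\<bar>measure lborel K *\<^sub>R g' x - (f (Sup K) - f (Inf K))\<bar>
          \<le> e / 2 * (Sup K - Inf K) + (if x \<in> N then \<bar>f (Sup K) - f (Inf K)\<bar> else 0)"
        proof (cases "x \<in> N")
          case True
          then show ?thesis using K(1,2) e2 by (simp add: g'_def abs_minus_commute)
        next
          case False
          then show ?thesis using d(2)[of x u v] K x uv by (simp add: g'_def G_def)
        qed
      qed
      also have "\<dots> = e / 2 * (b - a) + (\<Sum>(x,K)\<in>p. if x \<in> N then \<bar>f (Sup K) - f (Inf K)\<bar> else 0)"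
        unfolding telescope(1)[symmetric] sum_distrib_left
        by (simp add: case_prod_beta sum.distrib)
      also have "(\<Sum>(x,K)\<in>p. if x \<in> N then \<bar>f (Sup K) - f (Inf K)\<bar> else 0)
          = (\<Sum>(x,K)\<in>q. \<bar>f (Sup K) - f (Inf K)\<bar>)"
        unfolding q_def case_prod_beta by (rule sum.inter_filter[OF fin, symmetric])
      also have "e / 2 * (b - a) + \<dots> \<le> e * measure lborel {a..b}"
        using q_small \<open>a \<le> b\<close> by simp
      finally show ?thesis
        unfolding telescope(2)[symmetric] by (simp add: case_prod_beta sum_subtractf)
    qed
    show "\<exists>G. gauge G \<and> (\<forall>p. p tagged_division_of {a..b} \<and> G fine p \<longrightarrow>
        norm ((\<Sum>(x,K)\<in>p. measure lborel K *\<^sub>R g' x) - (f b - f a)) \<le> e * measure lborel {a..b})"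
    proof (intro exI[of _ G] conjI allI impI gauge)
      fix p assume "p tagged_division_of {a..b} \<and> G fine p"
      then show "norm ((\<Sum>(x,K)\<in>p. measure lborel K *\<^sub>R g' x) - (f b - f a)) \<le> e * measure lborel {a..b}"
        using riemann by blast
    qed
  qed
  then show ?thesis
    by (rule has_integral_spike[OF N, rotated]) (auto simp: g'_def)
qed

section \<open>Periodic solutions\<close>

text \<open>The difference \<open>d\<close> satisfies \<open>d' = - (lam + \<sigma>) * d\<close>
  almost everywhere, so \<open>d\<^sup>2\<close> has derivative
  \<open>- 2 * (lam + \<sigma>) * d\<^sup>2\<close>, whose integral over a period is 0. As
  \<open>\<sigma> \<ge> 0\<close> and \<open>lam > 0\<close>, the integral of
  \<open>d\<^sup>2\<close> is at most 0, and continuity forces \<open>d = 0\<close>.\<close>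

lemma periodic_solution_unique:
  assumes "lam > 0" "T > 0"
    and nonneg: "AE t\<in>{0..T} in lebesgue. \<sigma> t \<ge> 0"
    and x: "periodic_solution lam T \<sigma> x" and y: "periodic_solution lam T \<sigma> y"
    and t: "t \<in> {0..T}"
  shows "x t = y t"
proof -
  define d where "d t = x t - y t" for t
  have acx: "abs_continuous_on_interval 0 T x" and acy: "abs_continuous_on_interval 0 T y"
    using x y by (auto simp: periodic_solution_def caratheodory_solution_def)
  have acd: "abs_continuous_on_interval 0 T d"
    unfolding d_def by (rule abs_continuous_on_interval_diff[OF acx acy])
  have "AE t\<in>{0..T} in lebesgue. \<sigma> t \<ge> 0
      \<and> (x has_real_derivative (\<sigma> t * (1 - x t) - lam * x t)) (at t within {0..T})
      \<and> (y has_real_derivative (\<sigma> t * (1 - y t) - lam * y t)) (at t within {0..T})"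
    using nonneg x y unfolding periodic_solution_def caratheodory_solution_def by auto
  then obtain N where N: "negligible N"
    and NP: "\<And>t. t \<in> {0..T} - N \<Longrightarrow> \<sigma> t \<ge> 0
      \<and> (x has_real_derivative (\<sigma> t * (1 - x t) - lam * x t)) (at t within {0..T})
      \<and> (y has_real_derivative (\<sigma> t * (1 - y t) - lam * y t)) (at t within {0..T})"
    by (rule AE_on_negligibleE) blast
  have "((\<lambda>t. - 2 * (lam + \<sigma> t) * (d t)\<^sup>2) has_integral ((d T)\<^sup>2 - (d 0)\<^sup>2)) {0..T}"
  proof (rule fundamental_theorem_of_calculus_abs_continuous[OF _ _ N])
    fix t assume "t \<in> {0..T} - N"
    from NP[OF this] have "(x has_real_derivative (\<sigma> t * (1 - x t) - lam * x t)) (at t within {0..T})"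
      "(y has_real_derivative (\<sigma> t * (1 - y t) - lam * y t)) (at t within {0..T})" by auto
    then show "((\<lambda>t. (d t)\<^sup>2) has_real_derivative - 2 * (lam + \<sigma> t) * (d t)\<^sup>2) (at t within {0..T})"
      unfolding d_def
      by (auto intro!: derivative_eq_intros simp: power2_eq_square algebra_simps)
  qed (use \<open>T > 0\<close> acd in \<open>auto intro: abs_continuous_on_interval_power2\<close>)
  moreover have "d T = d 0"
    using x y by (simp add: d_def periodic_solution_def)
  ultimately have int0: "((\<lambda>t. - 2 * (lam + \<sigma> t) * (d t)\<^sup>2) has_integral 0) {0..T}"
    by simp
  have cont: "continuous_on {0..T} (\<lambda>t. (d t)\<^sup>2)"
    using abs_continuous_on_interval_imp_continuous_on[OF acd] by (intro continuous_intros)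
  then have int1: "((\<lambda>t. (- 2 * lam) * (d t)\<^sup>2) has_integral
      ((- 2 * lam) * integral {0..T} (\<lambda>t. (d t)\<^sup>2))) {0..T}"
    by (intro has_integral_mult_right integrable_integral integrable_continuous_real)
  \<comment> \<open>The integrand is altered on \<open>N\<close>, where
    \<open>\<sigma> \<ge> 0\<close> may fail, so that the comparison below holds at every
    point.\<close>
  have int2: "((\<lambda>t. if t \<in> N then (- 2 * lam) * (d t)\<^sup>2 else - 2 * (lam + \<sigma> t) * (d t)\<^sup>2)
      has_integral 0) {0..T}"
    by (rule has_integral_spike[OF N _ int0]) auto
  have "0 \<le> (- 2 * lam) * integral {0..T} (\<lambda>t. (d t)\<^sup>2)"
  proof (rule has_integral_le[OF int2 int1])
    fix t assume "t \<in> {0..T}"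
    then show "(if t \<in> N then (- 2 * lam) * (d t)\<^sup>2 else - 2 * (lam + \<sigma> t) * (d t)\<^sup>2)
        \<le> (- 2 * lam) * (d t)\<^sup>2"
      using NP[of t] by (auto simp: algebra_simps)
  qed
  then have "integral {0..T} (\<lambda>t. (d t)\<^sup>2) \<le> 0"
    using \<open>lam > 0\<close> by (simp add: mult_le_0_iff)
  moreover have "integral {0..T} (\<lambda>t. (d t)\<^sup>2) \<ge> 0"
    using cont by (intro integral_nonneg integrable_continuous_real) auto
  ultimately have "\<forall>t\<in>{0..T}. (d t)\<^sup>2 = 0"
    using integral_eq_0_iff[OF cont] \<open>T > 0\<close> by simp
  then show ?thesis using t by (simp add: d_def)
qed

text \<open>Periodic solutions agree on \<open>{0..T}\<close>, and \<open>mean_value\<close> sees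
  only that interval. Hence the description in \<open>w\<close> is proper and may be evaluated at
  any periodic solution.\<close>

lemma w_eq_mean_value:
  assumes "lam > 0" "T > 0" "AE t\<in>{0..T} in lebesgue. \<sigma> t \<ge> 0" "periodic_solution lam T \<sigma> x"
  shows "w lam T \<sigma> = lam * mean_value T x"
  unfolding w_def
proof (rule the_equality)
  show "\<exists>y. periodic_solution lam T \<sigma> y \<and> lam * mean_value T x = lam * mean_value T y"
    using assms(4) by blast
next
  fix v assume "\<exists>y. periodic_solution lam T \<sigma> y \<and> v = lam * mean_value T y"
  then obtain y where y: "periodic_solution lam T \<sigma> y" "v = lam * mean_value T y" by blast
  have "(LINT t:{0..T}|lebesgue. y t) = (LINT t:{0..T}|lebesgue. x t)"
    using periodic_solution_unique[OF assms(1-3) y(1) assms(4)]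
    by (intro set_lebesgue_integral_cong) auto
  then show "v = lam * mean_value T x" using y(2) by (simp add: mean_value_def)
qed

lemma mean_value_const: "T > 0 \<Longrightarrow> mean_value T (\<lambda>_. c) = c"
  by (simp add: mean_value_def set_lebesgue_integral_def)

text \<open>The equilibrium \<open>s / (lam + s)\<close> of the equation with constant rate
  \<open>s\<close> is a constant, hence periodic, solution.\<close>

lemma w_const:
  assumes "lam > 0" "T > 0" "s \<ge> 0"
  shows "w lam T (\<lambda>_. s) = lam * (s / (lam + s))"
proof -
  have "s * (1 - s / (lam + s)) - lam * (s / (lam + s)) = 0"
    using assms by (simp add: field_simps)
  then have "periodic_solution lam T (\<lambda>_. s) (\<lambda>_. s / (lam + s))"
    by (simp add: periodic_solution_def caratheodory_solution_def abs_continuous_on_interval_const)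
  then show ?thesis
    using w_eq_mean_value[of lam T "\<lambda>_. s"] assms by (simp add: mean_value_const)
qed

section \<open>Integral relations over a period and the final identity\<close>

lemma absolutely_integrable_continuous_mult_real:
  fixes f g :: "real \<Rightarrow> real"
  assumes "continuous_on {a..b} f" "g absolutely_integrable_on {a..b}"
  shows "(\<lambda>t. f t * g t) absolutely_integrable_on {a..b}"
proof (rule absolutely_integrable_bounded_measurable_product_real)
  show "f \<in> borel_measurable (lebesgue_on {a..b})"
    using assms(1) by (rule continuous_imp_measurable_on_sets_lebesgue) auto
  show "bounded (f ` {a..b})"
    using assms(1) by (intro compact_imp_bounded compact_continuous_image) auto
qed (use assms in auto)

theorem lemma1:
  fixes lam T \<sigma>\<^sub>m x\<^sub>s :: real and \<sigma> x\<^sub>p :: "real \<Rightarrow> real"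
  assumes "lam > 0" and "T > 0"
    and "\<sigma> absolutely_integrable_on {0..T}"
    and "AE t\<in>{0..T} in lebesgue. \<sigma> t \<ge> 0"
    and "periodic_solution lam T \<sigma> x\<^sub>p"
    and "\<sigma>\<^sub>m = mean_value T \<sigma>"
    and "x\<^sub>s = \<sigma>\<^sub>m / (lam + \<sigma>\<^sub>m)"
  shows "w lam T \<sigma> = w lam T (\<lambda>_. \<sigma>\<^sub>m)
           - 1 / T * (LINT t:{0..T}|lebesgue. (x\<^sub>p t - x\<^sub>s)\<^sup>2 * (lam + \<sigma> t))"
proof -
  \<comment> \<open>This keeps \<open>lam + \<sigma>\<^sub>m\<close> positive, as both
    \<open>x\<^sub>s\<close> and \<open>w_const\<close> require.\<close>
  have nonneg: "\<sigma>\<^sub>m \<ge> 0"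
    unfolding assms(6) mean_value_def set_lebesgue_integral_def
    using assms(2,4) by (intro mult_nonneg_nonneg integral_nonneg_AE) (auto simp: indicator_def)
  define x where "x = x\<^sub>p"
  have ac: "abs_continuous_on_interval 0 T x" and per: "x 0 = x T"
    and ode: "AE t\<in>{0..T} in lebesgue.
      (x has_real_derivative (\<sigma> t * (1 - x t) - lam * x t)) (at t within {0..T})"
    using assms(5) by (auto simp: x_def periodic_solution_def caratheodory_solution_def)
  obtain N where N: "negligible N" and deriv: "\<And>t. t \<in> {0..T} - N \<Longrightarrow>
      (x has_real_derivative (\<sigma> t * (1 - x t) - lam * x t)) (at t within {0..T})"
    using AE_on_negligibleE[OF ode] by blast
  have cont: "continuous_on {0..T} x"
    by (rule abs_continuous_on_interval_imp_continuous_on[OF ac])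
  have aS: "\<sigma> absolutely_integrable_on {0..T}" by fact
  have aA: "x absolutely_integrable_on {0..T}"
    by (rule absolutely_integrable_continuous_real[OF cont])
  have aC: "(\<lambda>t. (x t)\<^sup>2) absolutely_integrable_on {0..T}"
    using cont by (intro absolutely_integrable_continuous_real continuous_intros)
  have aB: "(\<lambda>t. x t * \<sigma> t) absolutely_integrable_on {0..T}"
    by (rule absolutely_integrable_continuous_mult_real[OF cont aS])
  have aD: "(\<lambda>t. (x t)\<^sup>2 * \<sigma> t) absolutely_integrable_on {0..T}"
    using cont by (intro absolutely_integrable_continuous_mult_real aS continuous_intros)
  define S where "S = (LINT t:{0..T}|lebesgue. \<sigma> t)"
  define A where "A = (LINT t:{0..T}|lebesgue. x t)"
  define B where "B = (LINT t:{0..T}|lebesgue. x t * \<sigma> t)"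
  define C where "C = (LINT t:{0..T}|lebesgue. (x t)\<^sup>2)"
  define D where "D = (LINT t:{0..T}|lebesgue. (x t)\<^sup>2 * \<sigma> t)"
  have S: "S = T * \<sigma>\<^sub>m" using assms(2,6) by (simp add: S_def mean_value_def)
  have xs: "x\<^sub>s * (lam + \<sigma>\<^sub>m) = \<sigma>\<^sub>m" using nonneg assms(1,7) by simp
  \<comment> \<open>The Lebesgue integrals are restated as gauge integrals, the form in which the
    fundamental theorem delivers its values.\<close>
  have hS: "(\<sigma> has_integral S) {0..T}"
    and hA: "(x has_integral A) {0..T}"
    and hB: "((\<lambda>t. x t * \<sigma> t) has_integral B) {0..T}"
    and hC: "((\<lambda>t. (x t)\<^sup>2) has_integral C) {0..T}"
    and hD: "((\<lambda>t. (x t)\<^sup>2 * \<sigma> t) has_integral D) {0..T}"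
    unfolding S_def A_def B_def C_def D_def
    by (rule has_integral_set_lebesgue aS aA aB aC aD)+
  have "((\<lambda>t. \<sigma> t * (1 - x t) - lam * x t) has_integral (x T - x 0)) {0..T}"
    using \<open>T > 0\<close> by (intro fundamental_theorem_of_calculus_abs_continuous[OF _ ac N] deriv) auto
  then have "((\<lambda>t. \<sigma> t - x t * \<sigma> t - lam * x t) has_integral (x T - x 0)) {0..T}"
    by (simp add: algebra_simps)
  moreover have "((\<lambda>t. \<sigma> t - x t * \<sigma> t - lam * x t) has_integral (S - B - lam * A)) {0..T}"
    by (intro has_integral_diff has_integral_mult_right hS hA hB)
  ultimately have "x T - x 0 = S - B - lam * A" by (rule has_integral_unique)
  then have first: "S - B - lam * A = 0" using per by simp
  \<comment> \<open>The integrand is \<open>2 * x * x'\<close> with the equation substituted for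
    \<open>x'\<close>; periodicity of \<open>x\<^sup>2\<close> then gives the second
    relation.\<close>
  have "((\<lambda>t. 2 * (x t * \<sigma> t - (x t)\<^sup>2 * \<sigma> t - lam * (x t)\<^sup>2)) has_integral ((x T)\<^sup>2 - (x 0)\<^sup>2)) {0..T}"
  proof (rule fundamental_theorem_of_calculus_abs_continuous[OF _ _ N])
    fix t assume "t \<in> {0..T} - N"
    from deriv[OF this]
    show "((\<lambda>t. (x t)\<^sup>2) has_real_derivative 2 * (x t * \<sigma> t - (x t)\<^sup>2 * \<sigma> t - lam * (x t)\<^sup>2))
        (at t within {0..T})"
      by (auto intro!: derivative_eq_intros simp: power2_eq_square algebra_simps)
  qed (use \<open>T > 0\<close> ac in \<open>auto intro: abs_continuous_on_interval_power2\<close>)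
  moreover have "((\<lambda>t. 2 * (x t * \<sigma> t - (x t)\<^sup>2 * \<sigma> t - lam * (x t)\<^sup>2)) has_integral
      (2 * (B - D - lam * C))) {0..T}"
    by (intro has_integral_diff has_integral_mult_right hB hC hD)
  ultimately have "(x T)\<^sup>2 - (x 0)\<^sup>2 = 2 * (B - D - lam * C)" by (rule has_integral_unique)
  then have second: "B - D - lam * C = 0" using per by simp
  \<comment> \<open>The terms are grouped into the two combinations that the relations evaluate:
    \<open>lam * C + D = B\<close> and \<open>lam * A + B = S\<close>.\<close>
  have expand: "(x t - x\<^sub>s)\<^sup>2 * (lam + \<sigma> t) = lam * (x t)\<^sup>2 + (x t)\<^sup>2 * \<sigma> t
      - 2 * x\<^sub>s * (lam * x t + x t * \<sigma> t) + x\<^sub>s\<^sup>2 * (lam + \<sigma> t)" for t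
    by (simp add: power2_eq_square algebra_simps)
  \<comment> \<open>Absolute integrability is what identifies the Lebesgue integral in the claim
    with the gauge integral computed next.\<close>
  have aQ: "(\<lambda>t. (x t - x\<^sub>s)\<^sup>2 * (lam + \<sigma> t)) absolutely_integrable_on {0..T}"
    using cont
    by (intro absolutely_integrable_continuous_mult_real continuous_intros set_integral_add aS
        absolutely_integrable_continuous_real)
  have "((\<lambda>t. (x t - x\<^sub>s)\<^sup>2 * (lam + \<sigma> t)) has_integral
      (lam * C + D - 2 * x\<^sub>s * (lam * A + B) + x\<^sub>s\<^sup>2 * (lam * T + S))) {0..T}"
    unfolding expand
    using has_integral_const_real[of lam 0 T] \<open>T > 0\<close>
    by (intro has_integral_diff has_integral_add has_integral_mult_right hS hA hB hC hD)
      (simp add: mult.commute)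
  then have "(LINT t:{0..T}|lebesgue. (x t - x\<^sub>s)\<^sup>2 * (lam + \<sigma> t))
      = lam * C + D - 2 * x\<^sub>s * (lam * A + B) + x\<^sub>s\<^sup>2 * (lam * T + S)"
    using set_lebesgue_integral_eq_integral(2)[OF aQ] by (simp add: integral_unique)
  also have "lam * C + D = B" using second by simp
  also have "lam * A + B = S" using first by simp
  \<comment> \<open>Here \<open>lam * T + S = T * (lam + \<sigma>\<^sub>m)\<close>, and one factor
    \<open>x\<^sub>s\<close> turns \<open>lam + \<sigma>\<^sub>m\<close> into
    \<open>\<sigma>\<^sub>m\<close>.\<close>
  also have "x\<^sub>s\<^sup>2 * (lam * T + S) = x\<^sub>s * S"
  proof -
    have "x\<^sub>s\<^sup>2 * (lam * T + S) = x\<^sub>s * T * (x\<^sub>s * (lam + \<sigma>\<^sub>m))"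
      by (simp add: S power2_eq_square algebra_simps)
    then show ?thesis by (simp add: xs S)
  qed
  finally have Q: "(LINT t:{0..T}|lebesgue. (x t - x\<^sub>s)\<^sup>2 * (lam + \<sigma> t)) = B - x\<^sub>s * S"
    by simp
  have "w lam T \<sigma> = lam * A / T"
    using w_eq_mean_value[OF assms(1,2,4,5)] by (simp add: mean_value_def A_def x_def)
  also have "lam * A = S - B" using first by simp
  \<comment> \<open>The splitting \<open>S = T * lam * x\<^sub>s + x\<^sub>s * S\<close>, from the
    definition of \<open>x\<^sub>s\<close>, separates the value at the constant rate from the
    quadratic defect \<open>B - x\<^sub>s * S\<close>.\<close>
  also have "(S - B) / T = lam * x\<^sub>s - 1 / T * (B - x\<^sub>s * S)"
  proof -
    have "S = T * (x\<^sub>s * (lam + \<sigma>\<^sub>m))" by (simp add: S xs)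
    also have "\<dots> = T * lam * x\<^sub>s + x\<^sub>s * S" by (simp add: S algebra_simps)
    finally show ?thesis using assms(2) by (simp add: field_simps)
  qed
  also have "lam * x\<^sub>s = w lam T (\<lambda>_. \<sigma>\<^sub>m)"
    using w_const[OF assms(1,2) nonneg] assms(7) by simp
  finally show ?thesis using Q by (simp add: x_def)
qed

end
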